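(* For any reduced surface $X:f=0$ of degree $d$ in $\mathbb{P}^3$ over $\mathbb{C}$, with exponents $d_1\le d_2\le d_3\le\dots\le d_p$, one has $$d_1\le d_2\le d_3\le d-1.$$
   Context: $S=\mathbb{C}[x,y,z,t]$ with its standard grading; $f\in S$ is homogeneous of degree $d$ and squarefree. $AR(f)=\{(a^x,a^y,a^z,a^t)\in S^4: a^xf_x+a^yf_y+a^zf_z+a^tf_t=0\}$ is the graded $S$-module of Jacobian syzygies of $f$, where a homogeneous syzygy has degree $e$ if its components are homogeneous of degree $e$. The exponents $d_1\le d_2\le\dots\le d_p$ ($p\ge 3$) of $X$ are the degrees of the elements of a minimal set of homogeneous generators of $AR(f)$. *)

theory Defs
  imports
    Complex_Main
    "HOL-Library.Poly_Mapping"
    "HOL-Library.Numeral_Type"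
    "HOL-Computational_Algebra.Squarefree"
    "HOL-Analysis.Finite_Cartesian_Product"
begin

text \<open>
  \<open>S = \<complex>[x,y,z,t]\<close>, as finitely supported functions from exponent vectors to
  coefficients; the four variables are indexed by the four-element type \<open>4\<close>.
\<close>

type_synonym monom4 = "4 \<Rightarrow>\<^sub>0 nat"

type_synonym poly4 = "monom4 \<Rightarrow>\<^sub>0 complex"

definition homogeneous :: "nat \<Rightarrow> poly4 \<Rightarrow> bool" where
  "homogeneous e p \<longleftrightarrow> (\<forall>m \<in> Poly_Mapping.keys p. (\<Sum>i\<in>UNIV. Poly_Mapping.lookup m i) = e)"

text \<open>
  If the variable \<open>i\<close> does not occur in the monomial \<open>m\<close>, the truncated
  \<open>m - Poly_Mapping.single i 1\<close> equals \<open>m\<close>, but the coefficient is then \<open>0\<close>.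
\<close>

definition partial_deriv :: "4 \<Rightarrow> poly4 \<Rightarrow> poly4" where
  "partial_deriv i p = (\<Sum>m \<in> Poly_Mapping.keys p.
     Poly_Mapping.single (m - Poly_Mapping.single i 1)
       (of_nat (Poly_Mapping.lookup m i) * Poly_Mapping.lookup p m))"

interpretation S4: module "(*s) :: poly4 \<Rightarrow> poly4 ^ 4 \<Rightarrow> poly4 ^ 4"
  by unfold_locales
    (simp_all add: vector_add_ldistrib vector_sadd_rdistrib vector_smult_assoc)

definition AR :: "poly4 \<Rightarrow> (poly4 ^ 4) set" where
  "AR f = {a. (\<Sum>i\<in>UNIV. a $ i * partial_deriv i f) = 0}"

definition homogeneous_syzygy :: "nat \<Rightarrow> poly4 ^ 4 \<Rightarrow> bool" where
  "homogeneous_syzygy e a \<longleftrightarrow> (\<forall>i. homogeneous e (a $ i))"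

definition minimal_generating_set :: "(poly4 ^ 4) set \<Rightarrow> (poly4 ^ 4) set \<Rightarrow> bool" where
  "minimal_generating_set G M \<longleftrightarrow> S4.span G = M \<and> (\<forall>H. H \<subset> G \<longrightarrow> S4.span H \<noteq> M)"

text \<open>
  \<open>exponents f [d\<^sub>1, \<dots>, d\<^sub>p]\<close>: the \<open>d\<^sub>j\<close> are, in increasing order and with repetitions,
  the degrees of the members of some minimal set of homogeneous generators of \<open>AR f\<close>.
  A relation rather than a function, so that a claim about all such lists depends neither
  on a choice of generators nor on uniqueness of the degrees.
\<close>

definition exponents :: "poly4 \<Rightarrow> nat list \<Rightarrow> bool" where
  "exponents f ds \<longleftrightarrow> sorted ds \<and>
     (\<exists>gs. distinct gs \<and> length gs = length ds \<and>
           minimal_generating_set (set gs) (AR f) \<and>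
           (\<forall>j < length ds. homogeneous_syzygy (ds ! j) (gs ! j)))"

end

theory Submission
  imports Defs
begin

text \<open>
  If at most two generators had degree at most \<open>d - 1\<close>, then, comparing homogeneous components
  of degree \<open>d - 1\<close>, all Koszul syzygies would lie in a submodule with two generators. But
  when \<open>h\<close> is a non-zero partial derivative, the three Koszul syzygies pairing \<open>h\<close> with the other
  partial derivatives have a \<open>3 \<times> 3\<close> minor \<open>-h\<^sup>3\<close>, whereas all \<open>3 \<times> 3\<close> minors vanish in such a submodule.
\<close>

definition mdeg :: "monom4 \<Rightarrow> nat" where
  "mdeg m = (\<Sum>i\<in>UNIV. Poly_Mapping.lookup m i)"

lemma mdeg_add: "mdeg (m + n) = mdeg m + mdeg n"
  by (simp add: mdeg_def lookup_add sum.distrib)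

lemma mdeg_single: "mdeg (Poly_Mapping.single i k) = k"
  by (simp add: mdeg_def lookup_single when_def)

lemma homogeneous_iff_lookup:
  "homogeneous e p \<longleftrightarrow> (\<forall>m. Poly_Mapping.lookup p m \<noteq> 0 \<longrightarrow> mdeg m = e)"
  by (auto simp: homogeneous_def mdeg_def in_keys_iff)

lemma minus_single_add:
  fixes m :: monom4
  assumes "Poly_Mapping.lookup m i \<noteq> 0"
  shows "m - Poly_Mapping.single i 1 + Poly_Mapping.single i 1 = m"
  using assms by (intro poly_mapping_eqI) (auto simp: lookup_add lookup_minus lookup_single when_def)

text \<open>Lowering the exponent of \<open>i\<close> is injective on the monomials that contain
  this variable, and the others carry the factor 0, so at most one summand contributes to each
  coefficient.\<close>

lemma lookup_partial_deriv:
  "Poly_Mapping.lookup (partial_deriv i p) m =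
     of_nat (Poly_Mapping.lookup m i + 1) * Poly_Mapping.lookup p (m + Poly_Mapping.single i 1)"
proof -
  let ?s = "Poly_Mapping.single i (1::nat)"
  have "Poly_Mapping.lookup (partial_deriv i p) m =
      (\<Sum>n\<in>Poly_Mapping.keys p. if n - ?s = m
         then of_nat (Poly_Mapping.lookup n i) * Poly_Mapping.lookup p n else 0)"
    by (simp add: partial_deriv_def lookup_sum lookup_single when_def)
  also have "\<dots> = (\<Sum>n\<in>Poly_Mapping.keys p. if n = m + ?s
         then of_nat (Poly_Mapping.lookup n i) * Poly_Mapping.lookup p n else 0)"
  proof (rule sum.cong[OF refl])
    fix n
    have "m + ?s - ?s = m" by simp
    moreover have "n - ?s + ?s = n" if "Poly_Mapping.lookup n i \<noteq> 0"
      using that by (rule minus_single_add)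
    ultimately show "(if n - ?s = m then of_nat (Poly_Mapping.lookup n i) * Poly_Mapping.lookup p n else 0)
      = (if n = m + ?s then of_nat (Poly_Mapping.lookup n i) * Poly_Mapping.lookup p n else 0)"
      by (cases "Poly_Mapping.lookup n i = 0") auto
  qed
  also have "\<dots> = of_nat (Poly_Mapping.lookup (m + ?s) i) * Poly_Mapping.lookup p (m + ?s)"
    by (auto simp: sum.delta in_keys_iff)
  finally show ?thesis by (simp add: lookup_add)
qed

text \<open>A non-zero coefficient of the derivative at \<open>m\<close> forces
  \<open>mdeg m + 1 = d\<close>. For \<open>d = 0\<close> the derivative is therefore zero, and the
  truncated \<open>d - 1\<close> is harmless.\<close>

lemma homogeneous_partial_deriv:
  assumes "homogeneous d p"
  shows "homogeneous (d - 1) (partial_deriv i p)"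
  using assms by (fastforce simp: homogeneous_iff_lookup lookup_partial_deriv mdeg_add mdeg_single)

text \<open>A monomial of positive degree contains some variable; differentiating by it multiplies
  the coefficient by a positive integer, which is non-zero in characteristic 0.\<close>

lemma ex_partial_deriv_nonzero:
  assumes "homogeneous d p" "d \<ge> 1" "p \<noteq> 0"
  obtains i where "partial_deriv i p \<noteq> 0"
proof -
  obtain m where m: "Poly_Mapping.lookup p m \<noteq> 0"
    using \<open>p \<noteq> 0\<close> by (metis lookup_zero poly_mapping_eqI)
  then have "mdeg m \<noteq> 0"
    using assms by (auto simp: homogeneous_iff_lookup)
  then obtain i where "Poly_Mapping.lookup m i \<noteq> 0"
    by (auto simp: mdeg_def)
  then have "m - Poly_Mapping.single i 1 + Poly_Mapping.single i 1 = m"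
    by (rule minus_single_add)
  then have "Poly_Mapping.lookup (partial_deriv i p) (m - Poly_Mapping.single i 1) \<noteq> 0"
    unfolding lookup_partial_deriv using m of_nat_neq_0 by simp
  then have "partial_deriv i p \<noteq> 0"
    by auto
  then show thesis by (rule that)
qed

definition hcomp :: "nat \<Rightarrow> poly4 \<Rightarrow> poly4" where
  "hcomp e p = (\<Sum>m | m \<in> Poly_Mapping.keys p \<and> mdeg m = e.
     Poly_Mapping.single m (Poly_Mapping.lookup p m))"

lemma lookup_hcomp:
  "Poly_Mapping.lookup (hcomp e p) m = (if mdeg m = e then Poly_Mapping.lookup p m else 0)"
  by (auto simp: hcomp_def lookup_sum lookup_single when_def sum.delta in_keys_iff)

lemma hcomp_zero: "hcomp e 0 = 0"
  by (simp add: hcomp_def)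

lemma hcomp_add: "hcomp e (p + q) = hcomp e p + hcomp e q"
  by (intro poly_mapping_eqI) (simp add: lookup_hcomp lookup_add)

lemma hcomp_homogeneous:
  "homogeneous s p \<Longrightarrow> hcomp e p = (if e = s then p else 0)"
  by (intro poly_mapping_eqI) (auto simp: lookup_hcomp homogeneous_iff_lookup)

text \<open>Both sides are additive in \<open>p\<close>, so it suffices to take a single term, whose
  product with \<open>q\<close> is again homogeneous. The case distinction guards the truncated
  \<open>e - s\<close>.\<close>

lemma hcomp_mult_homogeneous:
  assumes "homogeneous s q"
  shows "hcomp e (p * q) = (if s \<le> e then hcomp (e - s) p * q else 0)"
proof (induction p rule: update_induct)
  case const
  show ?case by (simp add: hcomp_zero)
next
  case (update p m a)
  have "homogeneous (mdeg m + s) (Poly_Mapping.single m a * q)"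
    using assms keys_mult[of "Poly_Mapping.single m a" q]
    by (fastforce simp: homogeneous_def mdeg_def[symmetric] mdeg_add split: if_splits)
  moreover have "homogeneous (mdeg m) (Poly_Mapping.single m a)"
    by (simp add: homogeneous_def mdeg_def)
  ultimately have "hcomp e (Poly_Mapping.single m a * q)
      = (if s \<le> e then hcomp (e - s) (Poly_Mapping.single m a) * q else 0)"
    by (auto simp: hcomp_homogeneous)
  moreover have "Poly_Mapping.update m a p = p + Poly_Mapping.single m a"
    using update(1)
    by (intro poly_mapping_eqI) (auto simp: lookup_update lookup_add lookup_single in_keys_iff)
  ultimately show ?case
    using update by (simp add: hcomp_add distrib_right)
qed

text \<open>Taking the part of degree \<open>e\<close> of a combination of the \<open>g j\<close>
  replaces each coefficient by its component of degree \<open>e - n j\<close>, and generators of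
  degree above \<open>e\<close> drop out.\<close>

lemma hcomp_span:
  assumes "x \<in> S4.span (g ` J)" and "\<And>j. j \<in> J \<Longrightarrow> homogeneous_syzygy (n j) (g j)"
  shows "(\<chi> i. hcomp e (x $ i)) \<in> S4.span (g ` {j \<in> J. n j \<le> e})"
  using assms(1)
proof (induction rule: S4.span_induct_alt)
  case base
  have "(\<chi> i. hcomp e ((0 :: poly4 ^ 4) $ i)) = 0"
    by (simp add: vec_eq_iff hcomp_zero)
  then show ?case by (simp only: S4.span_zero)
next
  case (step c y z)
  then obtain j where j: "j \<in> J" "y = g j" by auto
  let ?c = "if n j \<le> e then hcomp (e - n j) c else 0"
  have "(\<chi> i. hcomp e ((c *s y + z) $ i)) = ?c *s g j + (\<chi> i. hcomp e (z $ i))"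
    using assms(2)[OF j(1)] j(2)
    by (simp add: vec_eq_iff hcomp_add homogeneous_syzygy_def hcomp_mult_homogeneous[of "n j"])
  moreover have "?c *s g j \<in> S4.span (g ` {j \<in> J. n j \<le> e})"
    using j(1) by (auto intro: S4.span_scale S4.span_base S4.span_zero)
  ultimately show ?case
    using step by (simp only: S4.span_add)
qed

lemma span_two:
  assumes "x \<in> S4.span {u, v}"
  obtains a b where "x = a *s u + b *s v"
proof -
  obtain a where "x - a *s u \<in> S4.span {v}"
    using assms S4.span_breakdown_eq by blast
  then obtain b where "x - a *s u - b *s v \<in> S4.span {}"
    using S4.span_breakdown_eq by blast
  then have "x = a *s u + b *s v" by (simp add: algebra_simps)
  then show thesis by (rule that)
qed

definition koszul :: "4 \<Rightarrow> 4 \<Rightarrow> poly4 \<Rightarrow> poly4 ^ 4" where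
  "koszul i j f = axis i (partial_deriv j f) - axis j (partial_deriv i f)"

lemma koszul_in_AR: "koszul i j f \<in> AR f"
  by (simp add: AR_def koszul_def axis_def left_diff_distrib sum_subtractf
      if_distrib[where f = "\<lambda>x. x * _"] sum.delta cong: if_cong)

lemma hcomp_koszul:
  assumes "homogeneous d f" "i \<noteq> j"
  shows "(\<chi> k. hcomp (d - 1) (koszul i j f $ k)) = koszul i j f"
proof -
  have "homogeneous (d - 1) (- partial_deriv i f)"
    using homogeneous_partial_deriv[OF assms(1)] by (simp add: homogeneous_def)
  then show ?thesis
    using assms homogeneous_partial_deriv[OF assms(1)]
    by (simp add: vec_eq_iff koszul_def axis_def hcomp_homogeneous[of "d - 1"] hcomp_zero)
qed

text \<open>\<open>M\<close> factors through a free module of rank 2, so its minor on rows and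
  columns \<open>p\<close>, \<open>q\<close>, \<open>r\<close>, expanded here along row
  \<open>p\<close>, vanishes identically.\<close>

lemma det_rank_two_eq_0:
  fixes a b u v :: "'i \<Rightarrow> 'a::comm_ring"
  defines "M \<equiv> \<lambda>i j. a i * u j + b i * v j"
  shows "M p p * (M q q * M r r - M q r * M r q) - M p q * (M q p * M r r - M q r * M r p)
    + M p r * (M q p * M r q - M q q * M r p) = 0"
  unfolding M_def by (simp add: algebra_simps)

lemma koszul_not_in_span_two:
  assumes h: "partial_deriv i f \<noteq> 0"
  shows "\<exists>j. j \<noteq> i \<and> koszul i j f \<notin> S4.span {u, v}"
proof (rule ccontr)
  assume "\<not> ?thesis"
  then have in_span: "koszul i j f \<in> S4.span {u, v}" if "j \<noteq> i" for j
    using that by blast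
  \<comment> \<open>The sign is that of entry \<open>j\<close> of \<open>koszul i j f\<close>. With
    coordinate \<open>i\<close> dropped, the three Koszul vectors form \<open>h\<close> times the
    identity matrix.\<close>
  define h where "h = - partial_deriv i f"
  have "card (UNIV - {i}) = 3" by simp
  then obtain p q r where pqr: "UNIV - {i} = {p, q, r}" "p \<noteq> q" "p \<noteq> r" "q \<noteq> r"
    unfolding card_3_iff by metis
  then have i: "p \<noteq> i" "q \<noteq> i" "r \<noteq> i" by auto
  have "\<forall>j. \<exists>a b. j \<noteq> i \<longrightarrow> koszul i j f = a *s u + b *s v"
    using in_span span_two by metis
  then obtain a b where ab: "koszul i j f = a j *s u + b j *s v" if "j \<noteq> i" for j
    by metis
  have entry: "koszul i j f $ k = (if k = j then h else 0)" if "k \<noteq> i" for j k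
    using that by (auto simp: koszul_def axis_def h_def)
  have "a j * u $ k + b j * v $ k = (if k = j then h else 0)" if "j \<noteq> i" "k \<noteq> i" for j k
    using entry[OF that(2), of j] ab[OF that(1)] by simp
  \<comment> \<open>The left side is the determinant of that scalar matrix; a polynomial ring over a
    field has no zero divisors, so \<open>h\<close> would be 0.\<close>
  then have "h * (h * h) = 0"
    using det_rank_two_eq_0[of a p "($) u" b "($) v" q r] i pqr(2-4) by simp
  then show False using h by (simp add: h_def)
qed

theorem proposition4p11:
  fixes f :: poly4 and d :: nat and ds :: "nat list"
  assumes "d \<ge> 1" and "homogeneous d f" and "squarefree f"
    and "exponents f ds"
  shows "length ds \<ge> 3 \<and> ds ! 0 \<le> ds ! 1 \<and> ds ! 1 \<le> ds ! 2 \<and> ds ! 2 \<le> d - 1"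
proof -
  obtain gs where sorted: "sorted ds" and len: "length gs = length ds"
    and span: "S4.span (set gs) = AR f"
    and hom: "\<And>j. j < length ds \<Longrightarrow> homogeneous_syzygy (ds ! j) (gs ! j)"
    using assms(4) by (auto simp: exponents_def minimal_generating_set_def)
  have "f \<noteq> 0" using assms(3) by auto
  then obtain i where "partial_deriv i f \<noteq> 0"
    using ex_partial_deriv_nonzero assms(1,2) by metis
  \<comment> \<open>If \<open>gs\<close> has fewer than two members, some of these entries are
    unspecified vectors; this does no harm, since the lemma holds for any two vectors.\<close>
  then obtain j where j: "j \<noteq> i" "koszul i j f \<notin> S4.span {gs ! 0, gs ! 1}"
    using koszul_not_in_span_two by blast
  let ?J = "{k \<in> {..<length ds}. ds ! k \<le> d - 1}"
  have "set gs = (!) gs ` {..<length ds}"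
    using len by (auto simp: set_conv_nth)
  then have "koszul i j f \<in> S4.span ((!) gs ` {..<length ds})"
    using span koszul_in_AR by simp
  then have "(\<chi> k. hcomp (d - 1) (koszul i j f $ k)) \<in> S4.span ((!) gs ` ?J)"
    by (rule hcomp_span) (simp add: hom)
  then have in_span: "koszul i j f \<in> S4.span ((!) gs ` ?J)"
    using hcomp_koszul assms(2) j(1) by simp
  \<comment> \<open>An index of at least 2 in \<open>?J\<close> yields both conclusions: there are
    at least three generators, and by sortedness \<open>ds ! 2\<close> is at most
    \<open>d - 1\<close>.\<close>
  have "\<not> ?J \<subseteq> {0, 1}"
  proof
    assume "?J \<subseteq> {0, 1}"
    then have "(!) gs ` ?J \<subseteq> {gs ! 0, gs ! 1}" by blast
    then show False using in_span j(2) S4.span_mono by blast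
  qed
  then obtain k where k: "k < length ds" "ds ! k \<le> d - 1" "k \<ge> 2"
    by (auto simp: subset_iff)
  then have "ds ! 2 \<le> ds ! k" "ds ! 0 \<le> ds ! 1" "ds ! 1 \<le> ds ! 2"
    using sorted by (auto intro: sorted_nth_mono)
  with k show ?thesis by linarith
qed

end
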